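(* Let $\mathcal{A}$ be the set of strictly increasing sequences $\mathbf{i}=(i_1,i_2,\ldots)$ of positive integers, $1\leq i_1<i_2<\cdots$. (i) For every $\mathbf{i}\in\mathcal{A}$ the limit \[ I_{\mathbf{i}}=\lim_{r\to\infty}\int_{[0,1]^{i_r}}\frac{dx_1\cdots dx_{i_r}}{1-x_1\cdots x_{i_1}+x_1\cdots x_{i_2}-\cdots+(-1)^r x_1\cdots x_{i_r}} \] exists and $I_{\mathbf{i}}>1$. (The denominator is $1+\sum_{j=1}^r(-1)^j\prod_{m=1}^{i_j}x_m$.) (ii) The map $\xi:\mathcal{A}\to(1,+\infty)$, $\xi(\mathbf{i})=I_{\mathbf{i}}$, is injective, and $\xi(\mathcal{A})=(1,+\infty)\setminus\mathcal{Z}^{\star}$.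
   Context: $\mathcal{Z}^{\star}$ is the set of all multiple zeta-star values $\zeta^{\star}(k_1,\ldots,k_r)=\sum_{n_1\geq\cdots\geq n_r\geq 1}\frac{1}{n_1^{k_1}\cdots n_r^{k_r}}$ with $r\geq1$, $k_1\geq2$, $k_2,\ldots,k_r\geq1$ integers. *)

theory Defs
  imports "HOL-Analysis.Analysis"
begin

definition zeta_star :: "nat list \<Rightarrow> real" where
  "zeta_star ks =
     (\<Sum>\<^sub>\<infinity> ns \<in> {ns. length ns = length ks \<and> sorted_wrt (\<ge>) ns \<and> (\<forall>n\<in>set ns. n \<ge> 1)}.
        \<Prod>j<length ks. 1 / real (ns ! j) ^ (ks ! j))"

definition admissible :: "nat list \<Rightarrow> bool" where
  "admissible ks \<longleftrightarrow> ks \<noteq> [] \<and> hd ks \<ge> 2 \<and> (\<forall>k\<in>set ks. k \<ge> 1)"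

definition Zstar :: "real set" where
  "Zstar = zeta_star ` {ks. admissible ks}"

text \<open>Strictly increasing sequences of positive integers; i 0 plays the role of i_1.\<close>
definition seqA :: "(nat \<Rightarrow> nat) set" where
  "seqA = {i. strict_mono i \<and> i 0 \<ge> 1}"

text \<open>Denominator with r terms: 1 + sum_{j=1}^r (-1)^j x_1 ... x_{i_j}
  (with i_j = i (j-1)); coordinates x_1, x_2, ... are x 1, x 2, ...\<close>
definition denom :: "(nat \<Rightarrow> nat) \<Rightarrow> nat \<Rightarrow> (nat \<Rightarrow> real) \<Rightarrow> real" where
  "denom i r x = 1 + (\<Sum>j=1..r. (-1) ^ j * (\<Prod>m\<in>{1..i (j - 1)}. x m))"

text \<open>The integral over [0,1]^{i_r} (nonnegative Lebesgue integral, possibly infinite),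
  meaningful for r >= 1.\<close>
definition Iint :: "(nat \<Rightarrow> nat) \<Rightarrow> nat \<Rightarrow> ennreal" where
  "Iint i r = (\<integral>\<^sup>+ x. indicator (PiE {1..i (r - 1)} (\<lambda>_. {0..1::real})) x
                  * ennreal (1 / denom i r x)
               \<partial>(PiM {1..i (r - 1)} (\<lambda>_. lborel)))"

definition xi :: "(nat \<Rightarrow> nat) \<Rightarrow> real" where
  "xi i = enn2real (lim (\<lambda>r. Iint i r))"

end

(* Expanding 1/denominator as a geometric series and integrating out one coordinate at a time turns
   the r-th integral into a sum over n of an iterated operator word applied to either the constant 1
   (r odd) or the indicator of n = 1 (r even). The word has i_r letters, with i_1 letters of one
   kind, then i_2 - i_1 of the other, and so on. The two values are the endpoints of a cell attached
   to the word. A cell is split in two by appending a letter, and the splitting points are exactly the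
   multiple zeta-star values (words starting with False). So the limit of the integrals is the point
   with a prescribed binary expansion, in which both digits occur infinitely often because the
   letters keep changing. Expansions that are eventually constant would force the point to be an
   endpoint of a cell, that is, 1 or a splitting point. *)
theory Submission
  imports Defs
begin

section \<open>Operator words: linearity, monotone convergence, strict monotonicity\<close>

text \<open>Index \<open>m\<close> stands for the summation variable \<open>n = m + 1\<close> of a zeta-star value. Each letter
  contributes a factor \<open>1/n\<close>; \<open>True\<close> moreover passes to the next variable \<open>n' \<le> n\<close>.\<close>

definition step :: "bool \<Rightarrow> (nat \<Rightarrow> ennreal) \<Rightarrow> nat \<Rightarrow> ennreal" where
  "step b g m = ennreal (1 / real (Suc m)) * (if b then \<Sum>l\<le>m. g l else g m)"

definition steps :: "bool list \<Rightarrow> (nat \<Rightarrow> ennreal) \<Rightarrow> nat \<Rightarrow> ennreal" where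
  "steps s g = foldr step s g"

definition wsum :: "bool list \<Rightarrow> (nat \<Rightarrow> ennreal) \<Rightarrow> ennreal" where
  "wsum s g = (\<Sum>m. steps s g m)"

lemma steps_Nil [simp]: "steps [] g = g"
  and steps_Cons [simp]: "steps (b # s) g = step b (steps s g)"
  and steps_append: "steps (s @ t) g = steps s (steps t g)"
  by (simp_all add: steps_def)

lemma wsum_append: "wsum (s @ t) g = wsum s (steps t g)"
  by (simp add: wsum_def steps_append)

lemma step_mono: "(\<And>m. f m \<le> g m) \<Longrightarrow> step b f m \<le> step b g m"
  by (auto simp: step_def intro!: mult_left_mono sum_mono)

lemma steps_mono: "(\<And>m. f m \<le> g m) \<Longrightarrow> steps s f m \<le> steps s g m"
  by (induction s arbitrary: m) (auto intro: step_mono)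

lemma wsum_mono: "(\<And>m. f m \<le> g m) \<Longrightarrow> wsum s f \<le> wsum s g"
  unfolding wsum_def by (intro suminf_le steps_mono) auto

lemma step_add: "step b (\<lambda>m. f m + g m) m = step b f m + step b g m"
  by (simp add: step_def sum.distrib distrib_left)

lemma steps_add: "steps s (\<lambda>m. f m + g m) m = steps s f m + steps s g m"
proof (induction s arbitrary: m)
  case (Cons b s)
  have "steps s (\<lambda>m. f m + g m) = (\<lambda>m. steps s f m + steps s g m)"
    using Cons by auto
  then show ?case by (simp add: step_add)
qed simp

lemma wsum_add: "wsum s (\<lambda>m. f m + g m) = wsum s f + wsum s g"
  unfolding wsum_def steps_add by (rule suminf_add[symmetric]) auto

lemma step_cmult: "step b (\<lambda>m. c * g m) m = c * step b g m"
  by (simp add: step_def sum_distrib_left[symmetric] mult.left_commute)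

lemma steps_cmult: "steps s (\<lambda>m. c * g m) m = c * steps s g m"
proof (induction s arbitrary: m)
  case (Cons b s)
  have "steps s (\<lambda>m. c * g m) = (\<lambda>m. c * steps s g m)"
    using Cons by auto
  then show ?case by (simp add: step_cmult)
qed simp

lemma wsum_cmult: "wsum s (\<lambda>m. c * g m) = c * wsum s g"
  unfolding wsum_def steps_cmult by (rule ennreal_suminf_cmult)

lemma step_SUP:
  assumes "incseq f"
  shows "step b (\<lambda>m. SUP n. f n m) m = (SUP n. step b (f n) m)"
proof -
  have f: "incseq (\<lambda>n. f n m)" for m
    using assms by (auto simp: incseq_def le_fun_def)
  have "(\<Sum>l\<le>m. SUP n. f n l) = (SUP n. \<Sum>l\<le>m. f n l)"
    using f by (intro ennreal_SUP_sum[symmetric])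
  then show ?thesis
    by (simp add: step_def SUP_mult_left_ennreal)
qed

lemma steps_SUP:
  assumes "incseq f"
  shows "steps s (\<lambda>m. SUP n. f n m) m = (SUP n. steps s (f n) m)"
proof (induction s arbitrary: m)
  case (Cons b s)
  have inc: "incseq (\<lambda>n. steps s (f n))"
    using assms by (auto simp: incseq_def le_fun_def intro!: steps_mono)
  have "steps s (\<lambda>m. SUP n. f n m) = (\<lambda>m. SUP n. steps s (f n) m)"
    using Cons by auto
  then show ?case using step_SUP[OF inc] by simp
qed simp

lemma wsum_SUP:
  assumes "incseq f"
  shows "wsum s (\<lambda>m. SUP n. f n m) = (SUP n. wsum s (f n))"
  unfolding wsum_def steps_SUP[OF assms]
  using assms by (intro ennreal_suminf_SUP_eq) (auto simp: incseq_def le_fun_def intro!: steps_mono)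

lemma steps_pos:
  assumes "f 1 > 0" shows "steps s f 1 > 0"
proof (induction s)
  case (Cons b s)
  have "0 < steps s f 1" by fact
  also have "steps s f 1 \<le> (\<Sum>l\<le>1. steps s f l)"
    by (rule member_le_sum) auto
  finally show ?case
    using Cons by (auto simp: step_def ennreal_zero_less_mult_iff ennreal_inverse_positive)
qed (use assms in simp)

lemma wsum_pos:
  assumes "f 1 > 0" shows "wsum s f > 0"
proof -
  have "steps s f 1 \<le> wsum s f"
    unfolding wsum_def using sum_le_suminf[of "steps s f" "{1}"] by simp
  with steps_pos[of f s, OF assms] show ?thesis by (rule less_le_trans)
qed

text \<open>Index 1 is where \<open>delta\<close>, \<open>recip\<close> and the constant 1 first
  differ; all three agree at 0. The difference \<open>g - f\<close> has a positive sum, and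
  finiteness of \<open>wsum s f\<close> makes adding it a strict increase.\<close>

lemma wsum_strict_mono:
  assumes "wsum s f < top" and "\<And>m. f m \<le> g m" and "f 1 < g 1"
  shows "wsum s f < wsum s g"
proof -
  have g: "g = (\<lambda>m. f m + (g m - f m))"
    using assms(2) by (auto simp: add_diff_inverse_ennreal)
  have "g 1 - f 1 > 0" using assms(3) by (simp add: diff_gr0_ennreal)
  then have "wsum s (\<lambda>m. g m - f m) > 0" by (intro wsum_pos)
  then have "wsum s f + 0 < wsum s f + wsum s (\<lambda>m. g m - f m)"
    using assms(1) by (subst ennreal_add_left_cancel_less) auto
  then show ?thesis by (subst g) (simp add: wsum_add)
qed

section \<open>Nested cells and their splitting points\<close>

definition recip :: "nat \<Rightarrow> ennreal" where
  "recip m = ennreal (1 / real (Suc m))"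

definition delta :: "nat \<Rightarrow> ennreal" where
  "delta m = (if m = 0 then 1 else 0)"

text \<open>\<open>lower s \<le> middle s \<le> upper s\<close> are the cell attached to \<open>s\<close> and its splitting point: appending
  \<open>False\<close> to \<open>s\<close> keeps the left half, appending \<open>True\<close> the right half.\<close>

definition lower :: "bool list \<Rightarrow> ennreal" where "lower s = wsum s delta"
definition middle :: "bool list \<Rightarrow> ennreal" where "middle s = wsum s recip"
definition upper :: "bool list \<Rightarrow> ennreal" where "upper s = wsum s (\<lambda>_. 1)"

lemma ennreal_divide_Suc_mult: "ennreal (1 / real (Suc m)) * of_nat (Suc m) = 1"
proof -
  have "ennreal (1 / real (Suc m)) * ennreal (real (Suc m)) = ennreal (1 / real (Suc m) * real (Suc m))"
    by (rule ennreal_mult[symmetric]) auto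
  then show ?thesis by (simp add: ennreal_of_nat_eq_real_of_nat del: of_nat_Suc)
qed

text \<open>\<open>step True\<close> averages \<open>g 0, ..., g m\<close>, while
  \<open>step False\<close> divides \<open>g m\<close> by \<open>m + 1\<close>. An appended letter
  acts on the terminal function, so these identities are the source of the splitting rules
  \<open>lower_snoc\<close> and \<open>upper_snoc\<close>.\<close>

lemma step_False_delta: "step False delta = delta"
  and step_True_delta: "step True delta = recip"
  and step_False_one: "step False (\<lambda>_. 1) = recip"
  and step_True_one: "step True (\<lambda>_. 1) = (\<lambda>_. 1)"
proof -
  show "step True delta = recip" "step False delta = delta" "step False (\<lambda>_. 1) = recip"
    by (auto simp: step_def delta_def recip_def fun_eq_iff)
  show "step True (\<lambda>_. 1) = (\<lambda>_. 1)"
    using ennreal_divide_Suc_mult by (simp add: step_def fun_eq_iff)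
qed

lemma lower_snoc: "lower (s @ [b]) = (if b then middle s else lower s)"
  by (simp add: lower_def middle_def wsum_append step_False_delta step_True_delta)

lemma upper_snoc: "upper (s @ [b]) = (if b then upper s else middle s)"
  by (simp add: upper_def middle_def wsum_append step_False_one step_True_one)

lemma recip_le_one: "recip m \<le> 1"
  by (simp add: recip_def)

lemma delta_le_recip: "delta m \<le> recip m"
  by (simp add: recip_def delta_def)

lemma lower_le_middle: "lower s \<le> middle s"
  unfolding lower_def middle_def by (intro wsum_mono delta_le_recip)

lemma middle_le_upper: "middle s \<le> upper s"
  unfolding upper_def middle_def by (intro wsum_mono recip_le_one)

lemma lower_append_ge: "lower s \<le> lower (s @ t)"
proof (induction t rule: rev_induct)
  case (snoc b t)
  then show ?case
    using lower_snoc[of "s @ t" b] lower_le_middle[of "s @ t"] by (auto split: if_splits)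
qed simp

lemma upper_append_le: "upper (s @ t) \<le> upper s"
proof (induction t rule: rev_induct)
  case (snoc b t)
  then show ?case
    using upper_snoc[of "s @ t" b] middle_le_upper[of "s @ t"] by (auto split: if_splits)
qed simp

section \<open>Finiteness of endpoints and strictness of the splitting\<close>

lemma lower_Nil: "lower [] = 1"
proof -
  have "(\<Sum>m. delta m) = sum delta {0}"
    by (rule suminf_finite) (auto simp: delta_def)
  then show ?thesis by (simp add: lower_def wsum_def delta_def)
qed

text \<open>Divergence of the harmonic series. As the first splitting point is infinite, every
  finite point takes \<open>False\<close> as its first digit.\<close>

lemma middle_Nil: "middle [] = top"
proof (rule ccontr)
  assume "middle [] \<noteq> top"
  then have "(\<Sum>m. ennreal (1 / real (Suc m))) \<noteq> top"
    by (simp add: middle_def wsum_def recip_def)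
  then have "summable (\<lambda>m. 1 / real (Suc m))"
    by (intro summable_suminf_not_top) auto
  then have "summable (\<lambda>m. 1 / real m)"
    by (subst (asm) summable_Suc_iff)
  then show False
    using not_summable_harmonic[where 'a = real] by (simp add: inverse_eq_divide)
qed

lemma sum_inverse_sqrt_le: "(\<Sum>l\<le>m. 1 / sqrt (real (Suc l))) \<le> 2 * sqrt (real (Suc m))"
proof (induction m)
  case (Suc m)
  define a b where "a = sqrt (real (Suc m))" and "b = sqrt (real (Suc (Suc m)))"
  have ab: "b > 0" "b\<^sup>2 = a\<^sup>2 + 1" by (auto simp: a_def b_def)
  \<comment> \<open>The bound telescopes: \<open>2 * a * b \<le> a^2 + b^2 = 2 * b^2 - 1\<close>,
    divided by \<open>b\<close>, says that the new term \<open>1 / b\<close> is at most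
    \<open>2 * b - 2 * a\<close>.\<close>
  have "2 * a * b \<le> a\<^sup>2 + b\<^sup>2" using sum_squares_bound[of a b] by simp
  then have "2 * a * b + 1 \<le> 2 * b * b" using ab by (simp add: power2_eq_square)
  then have "2 * a + 1 / b \<le> 2 * b" using ab(1) by (simp add: field_simps)
  then show ?case using Suc by (simp add: a_def b_def)
qed simp

text \<open>Decay of order \<open>n^(-1/2)\<close> survives averaging at the cost of a factor 2 per
  letter, whereas order \<open>1 / n\<close> would pick up logarithms.\<close>

lemma steps_recip_le:
  "steps s recip m \<le> ennreal (2 ^ length s / sqrt (real (Suc m)))"
proof (induction s arbitrary: m)
  case Nil
  have "sqrt (real (Suc m)) \<le> real (Suc m)"
    using real_sqrt_le_mono[of "real (Suc m)" "(real (Suc m))\<^sup>2"] self_le_power[of "real (Suc m)" 2]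
    by simp
  then show ?case
    by (simp add: recip_def field_simps del: of_nat_Suc)
next
  case (Cons b s)
  define c where "c = (2::real) ^ length s"
  have c: "c > 0" by (simp add: c_def)
  define r where "r = sqrt (real (Suc m))"
  have r: "r > 0" "real (Suc m) = r * r" by (auto simp: r_def)
  have "(\<Sum>l\<le>m. steps s recip l) \<le> (\<Sum>l\<le>m. ennreal (c / sqrt (real (Suc l))))"
    using Cons by (intro sum_mono) (auto simp: c_def)
  also have "\<dots> = ennreal (c * (\<Sum>l\<le>m. 1 / sqrt (real (Suc l))))"
    using c by (subst sum_ennreal) (auto simp: sum_distrib_left)
  also have "\<dots> \<le> ennreal (c * (2 * r))"
    using c unfolding r_def by (intro ennreal_leI mult_left_mono sum_inverse_sqrt_le) auto
  finally have T: "(\<Sum>l\<le>m. steps s recip l) \<le> ennreal (c * (2 * r))" .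
  \<comment> \<open>A letter \<open>False\<close> obeys the same estimate, a single term being at
    most the whole sum.\<close>
  have "steps s recip m \<le> (\<Sum>l\<le>m. steps s recip l)"
    by (rule member_le_sum) auto
  with T have F: "steps s recip m \<le> ennreal (c * (2 * r))" by order
  have "step b (steps s recip) m \<le> ennreal (1 / real (Suc m)) * ennreal (c * (2 * r))"
    unfolding step_def using T F by (intro mult_left_mono) auto
  also have "\<dots> = ennreal (1 / real (Suc m) * (c * (2 * r)))"
    using c r by (intro ennreal_mult[symmetric]) auto
  also have "1 / real (Suc m) * (c * (2 * r)) = 2 * c / r"
    unfolding r(2) using r(1) by (simp add: field_simps)
  finally show ?case by (simp add: c_def r_def)
qed

text \<open>The leading \<open>False\<close> supplies one more factor \<open>1 / n\<close>, which
  improves the decay to the summable order \<open>n^(-3/2)\<close>.\<close>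

lemma middle_finite: "middle (False # s) < top"
proof -
  have sm: "summable (\<lambda>m. 2 ^ length s * real (Suc m) powr (-3/2))"
    using summable_real_powr_iff[of "-3/2"] by (intro summable_mult) (subst summable_Suc_iff, simp)
  have "middle (False # s) \<le> (\<Sum>m. ennreal (2 ^ length s * real (Suc m) powr (-3/2)))"
    unfolding middle_def wsum_def
  proof (rule suminf_le)
    fix m
    have "steps (False # s) recip m
        \<le> ennreal (1 / real (Suc m)) * ennreal (2 ^ length s / sqrt (real (Suc m)))"
      using steps_recip_le[of s m] by (simp add: step_def mult_left_mono)
    also have "\<dots> = ennreal (1 / real (Suc m) * (2 ^ length s / sqrt (real (Suc m))))"
      by (intro ennreal_mult[symmetric]) auto
    also have "1 / real (Suc m) * (2 ^ length s / sqrt (real (Suc m)))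
        = 2 ^ length s * real (Suc m) powr (-3/2)"
    proof -
      have "real (Suc m) powr (-3/2) = inverse (real (Suc m) powr (1 + 1/2))"
        by (subst powr_minus[symmetric]) simp
      also have "\<dots> = inverse (real (Suc m) * sqrt (real (Suc m)))"
        by (subst powr_add) (simp add: powr_half_sqrt)
      finally show ?thesis by (simp add: field_simps del: of_nat_Suc)
    qed
    finally show "steps (False # s) recip m \<le> ennreal (2 ^ length s * real (Suc m) powr (-3/2))" .
  qed auto
  also have "\<dots> = ennreal (\<Sum>m. 2 ^ length s * real (Suc m) powr (-3/2))"
    by (intro suminf_ennreal2 sm) auto
  also have "\<dots> < top" by simp
  finally show ?thesis .
qed

lemma lower_finite: "lower (False # s) < top"
  using lower_le_middle middle_finite by (rule le_less_trans)

text \<open>A closing \<open>False\<close> turns the upper endpoint into the splitting point of the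
  shorter word. By contrast, \<open>False\<close> followed only by letters \<open>True\<close> has
  an infinite upper endpoint.\<close>

lemma upper_finite:
  assumes "\<not> w"  shows "upper (False # s @ [w]) < top"
  using assms middle_finite[of s] upper_snoc[of "False # s" w] by simp

lemma recip_1_pos: "0 < recip 1" and recip_1_less: "recip 1 < 1"
  unfolding recip_def ennreal_1[symmetric] ennreal_0[symmetric]
  by (subst ennreal_less_iff; simp del: ennreal_1 ennreal_0)+

lemma lower_less_middle: "lower (False # s) < middle (False # s)"
  using lower_finite delta_le_recip unfolding lower_def middle_def
  by (rule wsum_strict_mono) (use recip_1_pos in \<open>simp add: delta_def\<close>)

lemma middle_less_upper: "middle (False # s) < upper (False # s)"
  using middle_finite recip_le_one unfolding upper_def middle_def
  by (rule wsum_strict_mono) (rule recip_1_less)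

lemma lower_Nil_less_middle: "lower [] < middle []"
  by (simp add: lower_Nil middle_Nil)

section \<open>Cell widths\<close>

definition psi :: "nat \<Rightarrow> ennreal" where
  "psi m = (if m = 0 then 0 else 1)"

text \<open>The width of a cell, given additively because both endpoints may be infinite and could
  not be subtracted.\<close>

definition gap :: "bool list \<Rightarrow> ennreal" where "gap s = wsum s psi"

lemma upper_eq: "upper s = lower s + gap s"
proof -
  have "(\<lambda>_. 1) = (\<lambda>m. delta m + psi m)" by (auto simp: delta_def psi_def)
  then show ?thesis unfolding upper_def lower_def gap_def by (simp add: wsum_add)
qed

text \<open>\<open>psi\<close> vanishes at index 0, and at every other index the factor
  \<open>1 / (m + 1)\<close> is at most 1/2.\<close>

lemma gap_snoc_False: "gap (s @ [False]) \<le> ennreal (1 / 2) * gap s"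
proof -
  have "step False psi m \<le> ennreal (1 / 2) * psi m" for m
  proof (cases "m = 0")
    case False
    then have "ennreal (1 / real (Suc m)) \<le> ennreal (1 / 2)"
      by (intro ennreal_leI) (auto simp: field_simps)
    then show ?thesis unfolding step_def by (intro mult_mono) auto
  qed (simp add: step_def psi_def)
  then show ?thesis
    unfolding gap_def wsum_append wsum_cmult[symmetric] by (intro wsum_mono) simp
qed

lemma gap_snoc_le: "gap (s @ [b]) \<le> gap s"
proof (cases b)
  case True
  have "step True psi m \<le> psi m" for m
  proof (cases "m = 0")
    case False
    have "(\<Sum>l\<le>m. psi l) \<le> (\<Sum>l\<le>m. 1)" by (intro sum_mono) (simp add: psi_def)
    then have "step True psi m \<le> step True (\<lambda>_. 1) m"
      by (auto simp: step_def intro!: mult_left_mono)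
    then show ?thesis using False unfolding step_True_one by (simp add: psi_def)
  qed (simp add: step_def psi_def)
  then show ?thesis
    using True unfolding gap_def wsum_append by (intro wsum_mono) simp
next
  case False
  have "gap (s @ [b]) \<le> ennreal (1 / 2) * gap s" using False gap_snoc_False by simp
  also have "\<dots> \<le> 1 * gap s"
    unfolding ennreal_1[symmetric] by (intro mult_right_mono ennreal_leI) auto
  finally show ?thesis by simp
qed

text \<open>The supremum is a fixed point of \<^term>\<open>step True\<close> with value \<open>1\<close> at \<open>0\<close>, hence constant.
  This excludes binary expansions ending in \<open>True\<close> only.\<close>

lemma SUP_steps_True_delta: "(SUP n. steps (replicate n True) delta m) = 1"
proof -
  define q where "q n = steps (replicate n True) delta" for n
  define h where "h m = (SUP n. q n m)" for m
  have q_Suc: "q (Suc n) = step True (q n)" for n by (simp add: q_def)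
  have "q n m \<le> q (Suc n) m" for n m
  proof (induction n arbitrary: m)
    case 0
    then show ?case by (simp add: q_def step_True_delta delta_le_recip)
  next
    case (Suc n)
    then show ?case unfolding q_Suc by (intro step_mono) (simp flip: q_Suc)
  qed
  then have inc: "incseq q" by (intro incseq_SucI) (simp add: le_fun_def)
  have h_step: "h = step True h"
  proof
    fix m
    have "step True h m = (SUP n. q (Suc n) m)"
      unfolding h_def step_SUP[OF inc] q_Suc ..
    also have "\<dots> = h m"
    proof (rule antisym)
      show "(SUP n. q (Suc n) m) \<le> h m"
        unfolding h_def by (intro SUP_least SUP_upper) auto
      show "h m \<le> (SUP n. q (Suc n) m)"
        unfolding h_def
        by (rule SUP_mono) (use inc in \<open>auto simp: incseq_Suc_iff le_fun_def\<close>)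
    qed
    finally show "h m = step True h m" by simp
  qed
  have q_le: "q n m \<le> 1" for n m
  proof -
    have "q n m \<le> steps (replicate n True) (\<lambda>_. 1) m"
      unfolding q_def by (intro steps_mono) (simp add: delta_def)
    also have "steps (replicate n True) (\<lambda>_. 1) = (\<lambda>_. 1)"
      by (induction n) (auto simp: step_True_one)
    finally show ?thesis .
  qed
  have h_le: "h m \<le> 1" for m unfolding h_def by (intro SUP_least q_le)
  have q0: "q n 0 = 1" for n
    by (induction n) (auto simp: q_Suc step_def, simp add: q_def delta_def)
  have "h m = 1" for m
  proof (induction m rule: less_induct)
    case (less m)
    show ?case
    proof (cases "m = 0")
      case True
      then show ?thesis by (simp add: h_def q0)
    next
      case False
      \<comment> \<open>\<open>h m\<close> is finite, so the fixed-point equation, with value 1 at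
        all smaller indices, becomes the real equation \<open>(m + 1) * r = m + r\<close>.\<close>
      obtain r where r: "h m = ennreal r" "r \<ge> 0"
        using h_le[of m] by (cases "h m") (auto simp: top_unique)
      have "h m = ennreal (1 / real (Suc m)) * (\<Sum>l\<le>m. h l)"
        by (subst h_step) (simp add: step_def)
      also have "(\<Sum>l\<le>m. h l) = (\<Sum>l<m. h l) + h m"
        by (simp flip: lessThan_Suc_atMost)
      also have "(\<Sum>l<m. h l) = of_nat m" using less by simp
      also have "\<dots> + h m = ennreal (real m + r)"
        using r by (simp add: ennreal_of_nat_eq_real_of_nat)
      also have "ennreal (1 / real (Suc m)) * \<dots> = ennreal (1 / real (Suc m) * (real m + r))"
        using r(2) by (intro ennreal_mult[symmetric]) auto
      finally have "r = 1 / real (Suc m) * (real m + r)"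
        using r by (subst (asm) r, subst (asm) ennreal_inj) auto
      then have "real m * r = real m * 1" by (simp add: field_simps)
      then show ?thesis using False r(1) by simp
    qed
  qed
  then show ?thesis by (simp add: h_def q_def)
qed

text \<open>Monotone convergence lifts the pointwise supremum to the sums: always taking the right
  half moves the lower endpoint up to the upper one, even an infinite one.\<close>

lemma SUP_lower_True: "(SUP n. lower (s @ replicate n True)) = upper s"
proof -
  have "steps (replicate n True) delta m \<le> steps (replicate (Suc n) True) delta m" for n m
    unfolding replicate_Suc steps_Cons
  proof (induction n arbitrary: m)
    case 0
    then show ?case by (simp add: step_True_delta delta_le_recip)
  next
    case (Suc n)
    then show ?case by (auto intro!: step_mono)
  qed
  then have "incseq (\<lambda>n. steps (replicate n True) delta)"
    by (intro incseq_SucI) (simp add: le_fun_def)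
  from wsum_SUP[OF this, of s] show ?thesis
    unfolding SUP_steps_True_delta lower_def upper_def wsum_append by simp
qed

section \<open>Points with prescribed digits\<close>

definition pre :: "(nat \<Rightarrow> bool) \<Rightarrow> nat \<Rightarrow> bool list" where
  "pre w n = map w [0..<n]"

lemma pre_0 [simp]: "pre w 0 = []"
  and pre_Suc: "pre w (Suc n) = pre w n @ [w n]"
  and length_pre [simp]: "length (pre w n) = n"
  by (simp_all add: pre_def)

lemma pre_Suc_Cons: "pre w (Suc n) = w 0 # pre (\<lambda>k. w (Suc k)) n"
  by (induction n) (auto simp: pre_Suc)

lemma incseq_lower_pre: "incseq (\<lambda>n. lower (pre w n))"
  by (intro incseq_SucI) (simp add: pre_Suc lower_append_ge)

lemma decseq_upper_pre: "decseq (\<lambda>n. upper (pre w n))"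
  by (intro decseq_SucI) (simp add: pre_Suc upper_append_le)

text \<open>Both letters recur forever, not necessarily in strict alternation. These turn out to be
  the digit sequences of exactly the finite points above 1 that are not splitting points of words
  starting with \<open>False\<close>.\<close>

definition alternating :: "(nat \<Rightarrow> bool) \<Rightarrow> bool" where
  "alternating w \<longleftrightarrow> \<not> w 0 \<and> (\<forall>n. \<exists>k\<ge>n. w k) \<and> (\<forall>n. \<exists>k\<ge>n. \<not> w k)"

lemma upper_pre_finite:
  assumes "\<not> w 0" "\<forall>n. \<exists>k\<ge>n. \<not> w k"
  shows "\<exists>k. upper (pre w k) < top"
proof -
  obtain k where k: "k \<ge> 1" "\<not> w k" using assms by blast
  then obtain j where "k = Suc j" by (cases k) auto
  then have "pre w (Suc k) = False # pre (\<lambda>k. w (Suc k)) j @ [w k]"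
    using assms by (simp add: \<open>k = Suc j\<close> pre_Suc[of w "Suc j"] pre_Suc_Cons[of w j])
  then show ?thesis using upper_finite[OF k(2)] by metis
qed

text \<open>The widths decrease and are at least halved at every \<open>False\<close>, so their
  limit satisfies \<open>l \<le> l / 2\<close>. Some upper endpoint is finite, hence so is
  \<open>l\<close>, and \<open>l\<close> is zero.\<close>

lemma gap_tendsto_0:
  assumes "\<not> w 0" "\<forall>n. \<exists>k\<ge>n. \<not> w k"
  shows "(\<lambda>n. gap (pre w n)) \<longlonglongrightarrow> 0"
proof -
  define l where "l = (INF n. gap (pre w n))"
  have dec: "decseq (\<lambda>n. gap (pre w n))"
    by (intro decseq_SucI) (simp add: pre_Suc gap_snoc_le)
  then have lim: "(\<lambda>n. gap (pre w n)) \<longlonglongrightarrow> l"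
    unfolding l_def by (rule LIMSEQ_INF)
  have "l \<le> ennreal (1 / 2) * gap (pre w n)" for n
  proof -
    obtain k where k: "k \<ge> n" "\<not> w k" using assms(2) by blast
    have "l \<le> gap (pre w (Suc k))" unfolding l_def by (rule INF_lower) simp
    also have "\<dots> \<le> ennreal (1 / 2) * gap (pre w k)"
      using k(2) gap_snoc_False by (simp add: pre_Suc)
    also have "\<dots> \<le> ennreal (1 / 2) * gap (pre w n)"
      using decseqD[OF dec k(1)] by (intro mult_left_mono) auto
    finally show ?thesis .
  qed
  then have "l \<le> ennreal (1 / 2) * l"
    by (intro LIMSEQ_le_const[OF ennreal_tendsto_cmult[OF ennreal_less_top lim]]) auto
  moreover have "l < top"
  proof -
    obtain k where "upper (pre w k) < top" using upper_pre_finite[OF assms] by blast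
    then have "gap (pre w k) < top" by (simp add: upper_eq)
    moreover have "l \<le> gap (pre w k)" unfolding l_def by (rule INF_lower) simp
    ultimately show ?thesis by (rule le_less_trans[rotated])
  qed
  ultimately have "l = 0"
  proof (cases l)
    case (real r)
    with \<open>l \<le> ennreal (1 / 2) * l\<close> have "ennreal r \<le> ennreal (1 / 2 * r)"
      by (subst ennreal_mult) auto
    then have "r \<le> 1 / 2 * r" using real by (subst (asm) ennreal_le_iff) auto
    then show ?thesis using real by simp
  qed simp
  with lim show ?thesis by simp
qed

definition wlim :: "(nat \<Rightarrow> bool) \<Rightarrow> ennreal" where
  "wlim w = (SUP n. lower (pre w n))"

lemma lower_tendsto: "(\<lambda>n. lower (pre w n)) \<longlonglongrightarrow> wlim w"
  unfolding wlim_def by (intro LIMSEQ_SUP incseq_lower_pre)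

lemma upper_tendsto:
  assumes "\<not> w 0" "\<forall>n. \<exists>k\<ge>n. \<not> w k"
  shows "(\<lambda>n. upper (pre w n)) \<longlonglongrightarrow> wlim w"
  using tendsto_add[OF lower_tendsto[of w] gap_tendsto_0[OF assms]] by (simp add: upper_eq)

lemma lower_middle_upper_pre:
  assumes "\<not> w 0"
  shows "lower (pre w n) < middle (pre w n)" and "n > 0 \<Longrightarrow> middle (pre w n) < upper (pre w n)"
  using assms lower_less_middle middle_less_upper lower_Nil_less_middle
  by (cases n; simp add: pre_Suc_Cons)+

text \<open>Strictness comes from recurrence: a later \<open>True\<close> strictly raises the lower
  endpoint, and a later \<open>False\<close> strictly lowers the upper one.\<close>

lemma wlim_bounds:
  assumes "alternating w"
  shows "lower (pre w n) < wlim w" and "wlim w < upper (pre w n)"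
proof -
  have w0: "\<not> w 0" using assms by (simp add: alternating_def)
  obtain k where k: "k \<ge> n" "w k" using assms by (auto simp: alternating_def)
  have "lower (pre w n) \<le> lower (pre w k)" by (rule incseqD[OF incseq_lower_pre k(1)])
  also have "\<dots> < lower (pre w (Suc k))"
    using k(2) w0 by (simp add: pre_Suc lower_snoc lower_middle_upper_pre)
  also have "\<dots> \<le> wlim w" unfolding wlim_def by (rule SUP_upper) simp
  finally show "lower (pre w n) < wlim w" .
  \<comment> \<open>\<open>Suc n\<close> keeps \<open>k\<close> positive: for the empty word
    \<open>middle\<close> and \<open>upper\<close> are both infinite, so that splitting does not
    lower the upper endpoint strictly.\<close>
  obtain k where k: "k \<ge> Suc n" "\<not> w k" using assms by (auto simp: alternating_def)
  have "wlim w \<le> upper (pre w (Suc k))"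
    using assms by (intro decseq_ge decseq_upper_pre upper_tendsto) (auto simp: alternating_def)
  also have "\<dots> < upper (pre w k)"
    using k w0 by (simp add: pre_Suc upper_snoc lower_middle_upper_pre)
  also have "\<dots> \<le> upper (pre w n)"
    using k by (intro decseqD[OF decseq_upper_pre]) auto
  finally show "wlim w < upper (pre w n)" .
qed

lemma first_difference:
  assumes "s \<noteq> pre w (length s)"
  shows "\<exists>n t. s = pre w n @ (\<not> w n) # t"
  using assms
proof (induction s rule: rev_induct)
  case (snoc b s)
  show ?case
  proof (cases "s = pre w (length s)")
    case True
    with snoc.prems have "s @ [b] = pre w (length s) @ [\<not> w (length s)]"
      by (auto simp: pre_Suc)
    then show ?thesis by blast
  qed (use snoc.IH in force)
qed simp

text \<open>If \<open>s\<close> is a prefix of \<open>w\<close>, its splitting point is an endpoint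
  of the next cell, whose interior contains \<open>wlim w\<close>. Otherwise \<open>s\<close> leaves
  \<open>w\<close> at some first letter, and its whole cell lies in the half not chosen by
  \<open>w\<close>.\<close>

lemma middle_neq_wlim:
  assumes "alternating w"
  shows "middle s \<noteq> wlim w"
proof (cases "s = pre w (length s)")
  case True
  then obtain n where s: "s = pre w n" by blast
  show ?thesis
    using wlim_bounds[OF assms, of "Suc n"]
    by (cases "w n") (auto simp: s pre_Suc lower_snoc upper_snoc)
next
  case False
  then obtain n t where s: "s = pre w n @ (\<not> w n) # t"
    using first_difference by blast
  have "lower ((pre w n @ [\<not> w n]) @ t) \<ge> lower (pre w n @ [\<not> w n])"
       "upper ((pre w n @ [\<not> w n]) @ t) \<le> upper (pre w n @ [\<not> w n])"
    by (rule lower_append_ge upper_append_le)+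
  then show ?thesis
    using wlim_bounds[OF assms, of "Suc n"] lower_le_middle[of s] middle_le_upper[of s]
    by (cases "w n") (auto simp: s pre_Suc lower_snoc upper_snoc)
qed

text \<open>The splitting point of the common prefix separates the two limits.\<close>

lemma wlim_less:
  assumes "alternating v" "alternating w" "pre v n = pre w n" "\<not> v n" "w n"
  shows "wlim v < wlim w"
  using wlim_bounds(2)[OF assms(1), of "Suc n"] wlim_bounds(1)[OF assms(2), of "Suc n"] assms(3-5)
  by (auto simp: pre_Suc lower_snoc upper_snoc)

lemma wlim_inj:
  assumes "alternating v" "alternating w" "wlim v = wlim w"
  shows "v = w"
proof (rule ccontr)
  assume "v \<noteq> w"
  then obtain m where "v m \<noteq> w m" by blast
  then obtain n where n: "v n \<noteq> w n" "\<And>k. k < n \<Longrightarrow> v k = w k"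
    using exists_least_iff[of "\<lambda>n. v n \<noteq> w n"] by blast
  then have "pre v n = pre w n" by (simp add: pre_def)
  then show False
    using n(1) wlim_less[of v w n] wlim_less[of w v n] assms by (cases "v n") auto
qed

lemma wlim_gt_1: "alternating w \<Longrightarrow> 1 < wlim w"
  using wlim_bounds(1)[of w 0] by (simp add: lower_Nil)

lemma wlim_finite: "alternating w \<Longrightarrow> wlim w < top"
  by (metis wlim_bounds(2) top_greatest less_le_trans)

primrec digits :: "ennreal \<Rightarrow> nat \<Rightarrow> bool list" where
  "digits x 0 = []"
| "digits x (Suc n) = digits x n @ [middle (digits x n) < x]"

text \<open>Bisection keeps \<open>x\<close> strictly inside every cell, since \<open>x\<close> is
  never a splitting point. A tail of \<open>True\<close> would push the lower endpoints up to an
  upper endpoint, and a tail of \<open>False\<close> would make \<open>x\<close> equal to a lower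
  endpoint; both contradict strictness.\<close>

lemma wlim_surj:
  assumes x: "1 < x" "x < top" and neq: "\<And>s. x \<noteq> middle (False # s)"
  shows "\<exists>w. alternating w \<and> wlim w = x"
proof -
  define w where "w n \<longleftrightarrow> middle (digits x n) < x" for n
  have pre: "pre w n = digits x n" for n
    by (induction n) (simp_all add: pre_Suc w_def)
  then have w_iff: "w n \<longleftrightarrow> middle (pre w n) < x" for n by (simp add: w_def)
  have w0: "\<not> w 0" using x by (simp add: w_def middle_Nil)
  have neq_pre: "x \<noteq> middle (pre w n)" for n
    using neq w0 x by (cases n) (auto simp: middle_Nil pre_Suc_Cons)
  have bounds: "lower (pre w n) < x \<and> x < upper (pre w n)" for n
  proof (induction n)
    case 0
    then show ?case
      using x middle_le_upper[of "[]"] by (simp add: lower_Nil middle_Nil top_unique)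
  next
    case (Suc n)
    then show ?case
      using neq_pre[of n] by (auto simp: pre_Suc lower_snoc upper_snoc w_iff[of n])
  qed
  have inf_False: "\<exists>k\<ge>n. \<not> w k" for n
  proof (rule ccontr)
    assume "\<not> ?thesis"
    then have "pre w (n + k) = pre w n @ replicate k True" for k
      by (induction k) (auto simp: pre_Suc replicate_append_same)
    then have "upper (pre w n) = (SUP k. lower (pre w (n + k)))"
      by (simp add: SUP_lower_True)
    also have "\<dots> \<le> x" using bounds by (intro SUP_least) (simp add: less_imp_le)
    finally show False using bounds[of n] by (simp add: leD)
  qed
  \<comment> \<open>Recurrence of \<open>False\<close> alone already makes the widths tend to
    0.\<close>
  have x_eq: "wlim w = x"
  proof (rule antisym)
    show "wlim w \<le> x"
      using bounds unfolding wlim_def by (intro SUP_least) (simp add: less_imp_le)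
    show "x \<le> wlim w"
      using bounds inf_False w0
      by (intro LIMSEQ_le_const[OF upper_tendsto]) (auto intro: less_imp_le)
  qed
  have inf_True: "\<exists>k\<ge>n. w k" for n
  proof (rule ccontr)
    assume no: "\<not> ?thesis"
    have "lower (pre w (n + k)) = lower (pre w n)" for k
      using no by (induction k) (auto simp: pre_Suc lower_snoc)
    then have "lower (pre w k) \<le> lower (pre w n)" for k
      using incseqD[OF incseq_lower_pre, of k "n + k" w] by simp
    then have "wlim w \<le> lower (pre w n)" unfolding wlim_def by (intro SUP_least)
    then show False using bounds[of n] x_eq by (simp add: leD)
  qed
  show ?thesis using w0 inf_False inf_True x_eq by (auto simp: alternating_def)
qed

section \<open>Splitting points as multiple zeta-star values\<close>

text \<open>The word of \<open>(k\<^sub>1, \<dots>, k\<^sub>r)\<close> carries one \<open>1/n\<^sub>r\<close> less than the summand; the missing factor is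
  supplied by \<^term>\<open>recip\<close>.\<close>

fun word :: "nat list \<Rightarrow> bool list" where
  "word [] = []"
| "word [k] = replicate (k - 1) False"
| "word (k # l # ks) = replicate (k - 1) False @ True # word (l # ks)"

definition summand :: "nat list \<Rightarrow> nat list \<Rightarrow> real" where
  "summand ks ns = (\<Prod>j<length ks. 1 / real (ns ! j) ^ (ks ! j))"

text \<open>Slices the summation range of \<open>zeta_star\<close> by the largest variable
  \<open>n_1 = m + 1\<close>, to match the index of \<open>steps\<close>.\<close>

definition indices :: "nat list \<Rightarrow> nat \<Rightarrow> nat list set" where
  "indices ks m = {ns. length ns = length ks \<and> sorted_wrt (\<ge>) ns \<and> (\<forall>n\<in>set ns. n \<ge> 1) \<and> hd ns = Suc m}"

lemma summand_Cons: "summand (k # ks) (n # ns) = 1 / real n ^ k * summand ks ns"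
  by (simp add: summand_def prod.lessThan_Suc_shift del: prod.lessThan_Suc)

lemma summand_nonneg: "summand ks ns \<ge> 0"
  by (auto simp: summand_def intro!: prod_nonneg)

lemma indices_singleton: "indices [k] m = {[Suc m]}"
  by (auto simp: indices_def length_Suc_conv)

lemma indices_Cons:
  assumes "ks \<noteq> []"
  shows "indices (k # ks) m = Cons (Suc m) ` (\<Union>l\<le>m. indices ks l)"
proof (intro equalityI subsetI)
  fix ns assume ns: "ns \<in> indices (k # ks) m"
  then obtain a p ps where "ns = a # p # ps"
    using assms by (cases ns; cases "tl ns"; cases ks) (auto simp: indices_def)
  with ns show "ns \<in> Cons (Suc m) ` (\<Union>l\<le>m. indices ks l)"
    by (intro image_eqI[where x = "p # ps"] UN_I[where a = "p - 1"]) (auto simp: indices_def)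
next
  fix ns assume "ns \<in> Cons (Suc m) ` (\<Union>l\<le>m. indices ks l)"
  then obtain l ps where ps: "l \<le> m" "ps \<in> indices ks l" "ns = Suc m # ps" by blast
  then obtain p qs where "ps = p # qs"
    using assms by (cases ps) (auto simp: indices_def)
  with ps show "ns \<in> indices (k # ks) m"
    by (force simp: indices_def)
qed

lemma finite_indices: "ks \<noteq> [] \<Longrightarrow> finite (indices ks m)"
proof (induction ks arbitrary: m)
  case (Cons k ks)
  then show ?case
    by (cases "ks = []") (auto simp: indices_singleton indices_Cons)
qed simp

lemma steps_replicate_False:
  "steps (replicate n False) g m = ennreal (1 / real (Suc m) ^ n) * g m"
proof (induction n)
  case (Suc n)
  have "ennreal (1 / real (Suc m)) * ennreal (1 / real (Suc m) ^ n) = ennreal (1 / real (Suc m) ^ Suc n)"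
    by (subst ennreal_mult[symmetric]) auto
  with Suc show ?case by (simp add: step_def mult.assoc[symmetric] del: of_nat_Suc)
qed simp

text \<open>A block of \<open>k - 1\<close> letters \<open>False\<close> and one \<open>True\<close>
  contributes \<open>1 / n ^ k\<close> and opens the sum over the next variable
  \<open>n' \<le> n\<close>; the slices for different \<open>n'\<close> are disjoint.\<close>

lemma steps_word:
  assumes "ks \<noteq> []" "\<forall>k\<in>set ks. k \<ge> 1"
  shows "steps (word ks) recip m = ennreal (\<Sum>ns\<in>indices ks m. summand ks ns)"
  using assms
proof (induction ks arbitrary: m rule: word.induct)
  case (2 k)
  then obtain n where "k = Suc n" by (cases k) auto
  then show ?case
    by (simp add: indices_singleton summand_def steps_replicate_False recip_def
        ennreal_mult[symmetric] mult.commute del: of_nat_Suc)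
next
  case (3 k l ks)
  define js where "js = l # ks"
  have js: "js \<noteq> []" by (simp add: js_def)
  define c where "c = real (Suc m)"
  obtain n where k: "k = Suc n" using 3(3) by (cases k) auto
  have IH: "steps (word js) recip m = ennreal (\<Sum>ns\<in>indices js m. summand js ns)" for m
    unfolding js_def using 3 by simp
  have disj: "indices js i \<inter> indices js j = {}" if "i \<noteq> j" for i j
    using that by (auto simp: indices_def)
  have "(\<Sum>ns\<in>indices (k # js) m. summand (k # js) ns)
      = (\<Sum>ps\<in>(\<Union>l\<le>m. indices js l). summand (k # js) (Suc m # ps))"
    unfolding indices_Cons[OF js] by (subst sum.reindex) auto
  also have "\<dots> = (\<Sum>ps\<in>(\<Union>l\<le>m. indices js l). 1 / c ^ k * summand js ps)"
    by (simp add: summand_Cons c_def)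
  also have "\<dots> = 1 / c ^ k * (\<Sum>l\<le>m. \<Sum>ps\<in>indices js l. summand js ps)"
    unfolding sum_distrib_left[symmetric]
    by (subst sum.UNION_disjoint) (use disj finite_indices[OF js] in auto)
  also have "ennreal \<dots> = ennreal (1 / c ^ k) * ennreal (\<Sum>l\<le>m. \<Sum>ps\<in>indices js l. summand js ps)"
    by (rule ennreal_mult) (auto simp: c_def intro!: sum_nonneg summand_nonneg)
  also have "ennreal (\<Sum>l\<le>m. \<Sum>ps\<in>indices js l. summand js ps) = (\<Sum>l\<le>m. steps (word js) recip l)"
    unfolding IH by (intro sum_ennreal[symmetric] sum_nonneg summand_nonneg)
  also have "ennreal (1 / c ^ k) = ennreal (1 / c ^ n) * ennreal (1 / c)"
    by (subst ennreal_mult[symmetric]) (auto simp: c_def k)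
  finally have "ennreal (\<Sum>ns\<in>indices (k # js) m. summand (k # js) ns)
      = ennreal (1 / c ^ n) * (ennreal (1 / c) * (\<Sum>l\<le>m. steps (word js) recip l))"
    by (simp add: mult.assoc)
  then show ?case
    unfolding js_def[symmetric]
    by (simp add: js_def[symmetric] steps_append steps_replicate_False k step_def c_def del: of_nat_Suc)
      (simp add: js_def steps_append steps_replicate_False step_def)
qed simp

lemma word_admissible: "admissible ks \<Longrightarrow> \<exists>s. word ks = False # s"
proof (induction ks rule: word.induct)
  case (2 k)
  then obtain n where "k = Suc (Suc n)" by (cases k; cases "k - 1") (auto simp: admissible_def)
  then show ?case by simp
next
  case (3 k l ks)
  then show ?case by (cases "k - 1") (auto simp: admissible_def)
qed (simp add: admissible_def)

text \<open>Prefixing \<open>True\<close> puts a new exponent 1 in front; prefixing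
  \<open>False\<close> raises the first exponent by one.\<close>

lemma word_surj: "\<exists>ks. ks \<noteq> [] \<and> (\<forall>k\<in>set ks. k \<ge> 1) \<and> word ks = s"
proof (induction s)
  case Nil
  show ?case by (intro exI[of _ "[1]"]) simp
next
  case (Cons b s)
  then obtain k ks where ks: "k \<ge> 1" "\<forall>k\<in>set ks. k \<ge> 1" "word (k # ks) = s"
    by (metis list.exhaust list.set_intros)
  show ?case
  proof (cases b)
    case True
    then show ?thesis using ks by (intro exI[of _ "1 # k # ks"]) simp
  next
    case False
    then have "word (Suc k # ks) = b # s"
      using ks by (cases ks; cases k) auto
    then show ?thesis using ks by (intro exI[of _ "Suc k # ks"]) simp
  qed
qed

lemma word_surj_admissible: "\<exists>ks. admissible ks \<and> word ks = False # s"
proof -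
  obtain ks where ks: "ks \<noteq> []" "\<forall>k\<in>set ks. k \<ge> 1" "word ks = False # s"
    using word_surj by blast
  then have "hd ks \<ge> 2"
    by (cases ks rule: word.cases; cases "hd ks - 1") auto
  with ks show ?thesis by (auto simp: admissible_def)
qed

text \<open>The tuples are grouped by their largest variable. Nonnegative terms and finiteness of
  \<open>middle\<close>, whose leading \<open>False\<close> comes from \<open>k_1 \<ge> 2\<close>,
  justify the regrouping of the unordered sum.\<close>

lemma middle_word:
  assumes "admissible ks"
  shows "middle (word ks) = ennreal (zeta_star ks)"
proof -
  have ks: "ks \<noteq> []" "\<forall>k\<in>set ks. k \<ge> 1" using assms by (auto simp: admissible_def)
  define r where "r m = (\<Sum>ns\<in>indices ks m. summand ks ns)" for m
  have r0: "r m \<ge> 0" for m by (auto simp: r_def intro!: sum_nonneg summand_nonneg)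
  have mid: "middle (word ks) = (\<Sum>m. ennreal (r m))"
    by (simp add: middle_def wsum_def steps_word[OF ks] r_def)
  have "(\<Sum>m. ennreal (r m)) \<noteq> top"
    using word_admissible[OF assms] middle_finite mid by (metis less_irrefl)
  then have sm: "summable r" using r0 by (intro summable_suminf_not_top) auto
  then have r: "(r has_sum suminf r) UNIV"
    using r0 by (intro sums_nonneg_imp_has_sum) (auto simp: summable_sums)
  have S: "{ns. length ns = length ks \<and> sorted_wrt (\<ge>) ns \<and> (\<forall>n\<in>set ns. n \<ge> 1)}
      = snd ` Sigma UNIV (indices ks)" (is "?S = _")
  proof (intro equalityI subsetI)
    fix ns assume ns: "ns \<in> ?S"
    then have "ns \<noteq> []" using ks by auto
    then have "hd ns \<ge> 1" using ns by auto
    then show "ns \<in> snd ` Sigma UNIV (indices ks)"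
      using ns by (intro image_eqI[where x = "(hd ns - 1, ns)"]) (auto simp: indices_def)
  qed (auto simp: indices_def)
  have inj: "inj_on snd (Sigma UNIV (indices ks))"
    by (auto simp: inj_on_def indices_def)
  have inner: "((\<lambda>ns. summand ks ns) has_sum r m) (indices ks m)" for m
    unfolding r_def by (rule has_sum_finite[OF finite_indices[OF ks(1)]])
  have "(\<lambda>(m, ns). summand ks ns) summable_on Sigma UNIV (indices ks)"
    by (rule summable_on_SigmaI[where g = r])
       (use inner r in \<open>auto simp: summable_on_def summand_nonneg\<close>)
  then have "((\<lambda>(m, ns). summand ks ns) has_sum suminf r) (Sigma UNIV (indices ks))"
    using inner r by (intro has_sum_SigmaI) auto
  then have "(summand ks has_sum suminf r) ?S"
    unfolding S by (subst has_sum_reindex[OF inj]) (simp add: comp_def case_prod_unfold)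
  then have "zeta_star ks = suminf r"
    unfolding zeta_star_def by (auto simp: summand_def[abs_def] dest: infsumI)
  then show ?thesis
    unfolding mid using sm r0 by (simp add: suminf_ennreal2)
qed

lemma zeta_star_nonneg: "zeta_star ks \<ge> 0"
  unfolding zeta_star_def by (intro infsum_nonneg prod_nonneg) auto

lemma ennreal_Zstar: "ennreal ` Zstar = range (\<lambda>s. middle (False # s))"
proof (intro equalityI subsetI)
  fix y assume "y \<in> ennreal ` Zstar"
  then obtain ks where ks: "admissible ks" "y = ennreal (zeta_star ks)"
    by (auto simp: Zstar_def)
  then have "y = middle (word ks)" by (simp add: middle_word)
  then show "y \<in> range (\<lambda>s. middle (False # s))" using word_admissible[OF ks(1)] by auto
next
  fix y assume "y \<in> range (\<lambda>s. middle (False # s))"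
  then obtain s where "y = middle (False # s)" by blast
  then show "y \<in> ennreal ` Zstar"
    using word_surj_admissible[of s] middle_word unfolding Zstar_def by (metis image_eqI mem_Collect_eq)
qed

section \<open>Integration over the cube, one coordinate at a time\<close>

text \<open>One minus the denominator of the integrand, unrolled by Horner's scheme. Its \<open>m\<close>-th moments over
  the cube are the values \<^term>\<open>steps s (\<lambda>m. ennreal (e ^ m)) m\<close>, because integrating out \<open>x\<^sub>k\<close> is one
  \<^term>\<open>step\<close>.\<close>

fun nest :: "bool list \<Rightarrow> real \<Rightarrow> nat \<Rightarrow> (nat \<Rightarrow> real) \<Rightarrow> real" where
  "nest [] e k x = e"
| "nest (b # s) e k x =
     (if b then 1 - x k * (1 - nest s e (Suc k) x) else x k * nest s e (Suc k) x)"

lemma nest_bounds: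
  assumes "0 \<le> e" "e \<le> 1" "\<And>j. j \<in> {k..<k + length s} \<Longrightarrow> x j \<in> {0..1}"
  shows "0 \<le> nest s e k x \<and> nest s e k x \<le> 1"
  using assms(3)
proof (induction s arbitrary: k)
  case (Cons b s)
  define y where "y = nest s e (Suc k) x"
  have y: "0 \<le> y" "y \<le> 1" using Cons by (auto simp: y_def)
  have x: "0 \<le> x k" "x k \<le> 1" using Cons.prems[of k] by auto
  have "x k * y \<le> 1" "x k * (1 - y) \<le> 1" using x y by (auto intro!: mult_le_one)
  then show ?case using x y by (simp flip: y_def)
qed (use assms in simp)

lemma nest_upd: "j < k \<Longrightarrow> nest s e k (x(j := y)) = nest s e k x"
  by (induction s arbitrary: k) auto

lemma nest_measurable:
  assumes "{k..<k + length s} \<subseteq> I"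
  shows "nest s e k \<in> borel_measurable (PiM I (\<lambda>_. lborel))"
  using assms
proof (induction s arbitrary: k)
  case (Cons b s)
  have [measurable]: "nest s e (Suc k) \<in> borel_measurable (PiM I (\<lambda>_. lborel))"
    by (rule Cons.IH) (use Cons.prems in auto)
  have "(\<lambda>x. x k) \<in> measurable (PiM I (\<lambda>_. lborel)) lborel"
    using Cons.prems by (intro measurable_component_singleton) auto
  then have [measurable]: "(\<lambda>x. x k) \<in> borel_measurable (PiM I (\<lambda>_. lborel :: real measure))"
    by simp
  show ?case by simp
next
  case Nil
  have "nest [] e k = (\<lambda>_. e)" by auto
  then show ?case by simp
qed

lemma PiE_unit_measurable [measurable]:
  "finite I \<Longrightarrow> PiE I (\<lambda>_. {0..1::real}) \<in> sets (PiM I (\<lambda>_. lborel))"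
  by (intro sets_PiM_I_finite) auto

text \<open>\<open>(t * y) ^ m\<close> integrates to \<open>y ^ m / (m + 1)\<close>, and
  \<open>(1 - t * (1 - y)) ^ m\<close> to the average of \<open>y ^ 0, ..., y ^ m\<close> by the
  finite geometric sum.\<close>

lemma integral_unit_step:
  assumes y: "0 \<le> y" "y \<le> 1"
  shows "(\<integral>\<^sup>+t. indicator {0..1} t * ennreal ((if b then 1 - t * (1 - y) else t * y) ^ m) \<partial>lborel)
      = step b (\<lambda>m. ennreal (y ^ m)) m"
proof -
  have unit: "t * (1 - y) \<le> 1" if "0 \<le> t" "t \<le> 1" for t :: real
    using that y by (intro mult_le_one) auto
  \<comment> \<open>\<open>y = 1\<close> is separate because the antiderivative in the last case
    divides by \<open>1 - y\<close>.\<close>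
  consider "\<not> b" | "b" "y = 1" | "b" "y < 1" using y by force
  then show ?thesis
  proof cases
    case 1
    have "(\<integral>\<^sup>+t. ennreal ((t * y) ^ m) * indicator {0..1} t \<partial>lborel)
        = ennreal (1 ^ Suc m / real (Suc m) * y ^ m - 0 ^ Suc m / real (Suc m) * y ^ m)"
    proof (rule nn_integral_FTC_Icc)
      fix t :: real
      have "((\<lambda>t. t ^ Suc m / real (Suc m) * y ^ m) has_real_derivative
          real (Suc m) * t ^ m / real (Suc m) * y ^ m) (at t)"
        using DERIV_pow[of "Suc m" t] by (intro DERIV_cmult_right DERIV_cdivide) simp
      then show "((\<lambda>t. t ^ Suc m / real (Suc m) * y ^ m) has_real_derivative (t * y) ^ m) (at t)"
        by (simp add: power_mult_distrib del: of_nat_Suc)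
    qed (use y in auto)
    also have "\<dots> = ennreal (1 / real (Suc m)) * ennreal (y ^ m)"
      using y by (simp flip: ennreal_mult)
    finally show ?thesis using 1 by (simp add: step_def mult.commute)
  next
    case 2
    then show ?thesis
      using ennreal_divide_Suc_mult[of m] by (simp add: step_def)
  next
    case 3
    define F where "F t = - ((1 - t * (1 - y)) ^ Suc m / (real (Suc m) * (1 - y)))" for t
    have "(\<integral>\<^sup>+t. ennreal ((1 - t * (1 - y)) ^ m) * indicator {0..1} t \<partial>lborel) = ennreal (F 1 - F 0)"
    proof (rule nn_integral_FTC_Icc)
      fix t :: real
      have "((\<lambda>t. (1 - t * (1 - y)) ^ Suc m) has_real_derivative
          real (Suc m) * (1 - t * (1 - y)) ^ (Suc m - Suc 0) * (- (1 - y))) (at t)"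
        by (rule DERIV_chain2[OF DERIV_pow]) (auto intro!: derivative_eq_intros)
      then have "(F has_real_derivative
          - (real (Suc m) * (1 - t * (1 - y)) ^ m * (- (1 - y)) / (real (Suc m) * (1 - y)))) (at t)"
        unfolding F_def by (intro DERIV_minus DERIV_cdivide) simp
      also have "- (real (Suc m) * (1 - t * (1 - y)) ^ m * (- (1 - y)) / (real (Suc m) * (1 - y)))
          = (1 - t * (1 - y)) ^ m"
        using 3 by (simp add: field_simps del: of_nat_Suc)
      finally show "(F has_real_derivative (1 - t * (1 - y)) ^ m) (at t)" .
    qed (use unit in auto)
    also have "F 1 - F 0 = (1 - y ^ Suc m) / (real (Suc m) * (1 - y))"
      by (simp add: F_def diff_divide_distrib)
    also have "1 - y ^ Suc m = (1 - y) * (\<Sum>l\<le>m. y ^ l)"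
      by (simp only: one_diff_power_eq lessThan_Suc_atMost)
    also have "\<dots> / (real (Suc m) * (1 - y)) = 1 / real (Suc m) * (\<Sum>l\<le>m. y ^ l)"
      using 3 by (simp del: of_nat_Suc)
    also have "ennreal \<dots> = ennreal (1 / real (Suc m)) * (\<Sum>l\<le>m. ennreal (y ^ l))"
      using y by (subst ennreal_mult) (auto intro!: sum_nonneg simp: sum_ennreal)
    finally show ?thesis using 3 by (simp add: step_def mult.commute)
  qed
qed

interpretation lborel_product: product_sigma_finite "\<lambda>_::nat. lborel :: real measure"
  by standard

lemma atLeastLessThan_Suc_insert: "{k..<k + length (b # s)} = insert k {Suc k..<Suc k + length s}"
  by auto

lemma indicator_PiE_upd:
  assumes "x \<in> space (PiM I (\<lambda>_. lborel :: real measure))" "k \<notin> I"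
  shows "indicator (PiE (insert k I) (\<lambda>_. {0..1})) (x(k := t))
       = (indicator (PiE I (\<lambda>_. {0..1})) x * indicator {0..1} t :: ennreal)"
proof -
  have "x(k := t) \<in> PiE (insert k I) (\<lambda>_. {0..1}) \<longleftrightarrow> x \<in> PiE I (\<lambda>_. {0..1}) \<and> t \<in> {0..1}"
    using assms by (auto simp: space_PiM PiE_iff extensional_def)
  then show ?thesis by (auto simp: indicator_def)
qed

text \<open>Fubini, splitting off the outermost coordinate \<open>x k\<close>. A general
  \<open>h\<close> covers both the powers in the moments and the kernel \<open>1 / (1 - z)\<close>.
  The values of \<open>J\<close> matter only on the unit interval, where the cube confines
  \<open>nest\<close>.\<close>

lemma integral_nest_Cons:
  fixes s b k defines "I \<equiv> {Suc k..<Suc k + length s}"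
  assumes e: "0 \<le> e" "e \<le> 1"
    and [measurable]: "h \<in> borel_measurable borel"
    and J: "\<And>y. 0 \<le> y \<Longrightarrow> y \<le> 1 \<Longrightarrow>
      (\<integral>\<^sup>+t. indicator {0..1} t * h (if b then 1 - t * (1 - y) else t * y) \<partial>lborel) = J y"
  shows "(\<integral>\<^sup>+x. indicator (PiE {k..<k + length (b # s)} (\<lambda>_. {0..1})) x * h (nest (b # s) e k x)
           \<partial>PiM {k..<k + length (b # s)} (\<lambda>_. lborel))
       = (\<integral>\<^sup>+x. indicator (PiE I (\<lambda>_. {0..1})) x * J (nest s e (Suc k) x) \<partial>PiM I (\<lambda>_. lborel))"
proof -
  have I: "finite I" "k \<notin> I" by (auto simp: I_def)
  have [measurable]: "nest (b # s) e k \<in> borel_measurable (PiM (insert k I) (\<lambda>_. lborel))"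
    by (rule nest_measurable) (auto simp: I_def)
  have [measurable]: "PiE (insert k I) (\<lambda>_. {0..1::real}) \<in> sets (PiM (insert k I) (\<lambda>_. lborel))"
    using I by (intro PiE_unit_measurable) auto
  have "(\<integral>\<^sup>+x. indicator (PiE (insert k I) (\<lambda>_. {0..1})) x * h (nest (b # s) e k x)
           \<partial>PiM (insert k I) (\<lambda>_. lborel))
      = (\<integral>\<^sup>+x. \<integral>\<^sup>+t. indicator (PiE (insert k I) (\<lambda>_. {0..1})) (x(k := t)) * h (nest (b # s) e k (x(k := t)))
           \<partial>lborel \<partial>PiM I (\<lambda>_. lborel))"
    by (intro lborel_product.product_nn_integral_insert I) measurable
  also have "\<dots> = (\<integral>\<^sup>+x. indicator (PiE I (\<lambda>_. {0..1})) x * J (nest s e (Suc k) x) \<partial>PiM I (\<lambda>_. lborel))"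
  proof (rule nn_integral_cong)
    fix x assume x: "x \<in> space (PiM I (\<lambda>_. lborel :: real measure))"
    define y where "y = nest s e (Suc k) x"
    have "(\<integral>\<^sup>+t. indicator (PiE (insert k I) (\<lambda>_. {0..1})) (x(k := t)) * h (nest (b # s) e k (x(k := t))) \<partial>lborel)
        = (\<integral>\<^sup>+t. indicator (PiE I (\<lambda>_. {0..1})) x *
             (indicator {0..1} t * h (if b then 1 - t * (1 - y) else t * y)) \<partial>lborel)"
      by (intro nn_integral_cong)
         (simp add: indicator_PiE_upd[OF x I(2)] nest_upd y_def mult.assoc)
    also have "\<dots> = indicator (PiE I (\<lambda>_. {0..1})) x *
             (\<integral>\<^sup>+t. indicator {0..1} t * h (if b then 1 - t * (1 - y) else t * y) \<partial>lborel)"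
      by (intro nn_integral_cmult) simp
    also have "\<dots> = indicator (PiE I (\<lambda>_. {0..1})) x * J y"
    proof (cases "x \<in> PiE I (\<lambda>_. {0..1})")
      case True
      then have "0 \<le> y \<and> y \<le> 1"
        unfolding y_def using e by (intro nest_bounds) (auto simp: I_def PiE_iff)
      then show ?thesis by (simp add: J)
    qed simp
    finally show "(\<integral>\<^sup>+t. indicator (PiE (insert k I) (\<lambda>_. {0..1})) (x(k := t)) * h (nest (b # s) e k (x(k := t))) \<partial>lborel)
        = indicator (PiE I (\<lambda>_. {0..1})) x * J (nest s e (Suc k) x)" by (simp add: y_def)
  qed
  finally show ?thesis unfolding atLeastLessThan_Suc_insert I_def .
qed

lemma nest_moment:
  assumes e: "0 \<le> e" "e \<le> 1"
  shows "(\<integral>\<^sup>+x. indicator (PiE {k..<k + length s} (\<lambda>_. {0..1})) x * ennreal (nest s e k x ^ m)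
           \<partial>PiM {k..<k + length s} (\<lambda>_. lborel)) = steps s (\<lambda>m. ennreal (e ^ m)) m"
proof (induction s arbitrary: k m)
  case Nil
  show ?case by (simp add: lborel_product.nn_integral_empty)
next
  case (Cons b s)
  define I where "I = {Suc k..<Suc k + length s}"
  define M where "M = PiM I (\<lambda>_. lborel :: real measure)"
  define u where "u = (indicator (PiE I (\<lambda>_. {0..1})) :: (nat \<Rightarrow> real) \<Rightarrow> ennreal)"
  have [measurable]: "u \<in> borel_measurable M" "nest s e (Suc k) \<in> borel_measurable M"
    unfolding u_def M_def I_def
    by (auto intro!: borel_measurable_indicator PiE_unit_measurable nest_measurable)
  have IH: "(\<integral>\<^sup>+x. u x * ennreal (nest s e (Suc k) x ^ m) \<partial>M) = steps s (\<lambda>m. ennreal (e ^ m)) m" for m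
    unfolding u_def M_def I_def by (rule Cons.IH)
  have "(\<integral>\<^sup>+x. indicator (PiE {k..<k + length (b # s)} (\<lambda>_. {0..1})) x * ennreal (nest (b # s) e k x ^ m)
           \<partial>PiM {k..<k + length (b # s)} (\<lambda>_. lborel))
      = (\<integral>\<^sup>+x. u x * step b (\<lambda>m. ennreal (nest s e (Suc k) x ^ m)) m \<partial>M)"
    unfolding u_def M_def I_def
    by (rule integral_nest_Cons[OF e]) (simp_all add: integral_unit_step)
  also have "\<dots> = (\<integral>\<^sup>+x. ennreal (1 / real (Suc m)) *
        (if b then \<Sum>l\<le>m. u x * ennreal (nest s e (Suc k) x ^ l) else u x * ennreal (nest s e (Suc k) x ^ m)) \<partial>M)"
    by (intro nn_integral_cong) (simp add: step_def sum_distrib_left[symmetric] mult.left_commute)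
  also have "\<dots> = ennreal (1 / real (Suc m)) *
        (if b then \<Sum>l\<le>m. \<integral>\<^sup>+x. u x * ennreal (nest s e (Suc k) x ^ l) \<partial>M
         else \<integral>\<^sup>+x. u x * ennreal (nest s e (Suc k) x ^ m) \<partial>M)"
    by (cases b) (simp_all add: nn_integral_cmult nn_integral_sum del: of_nat_Suc)
  finally show ?case by (simp add: IH step_def)
qed

lemma integral_unit_geometric:
  assumes y: "0 \<le> y" "y \<le> 1"
  shows "(\<integral>\<^sup>+t. indicator {0..1} t * ennreal (1 / (1 - t * y)) \<partial>lborel)
      = (\<Sum>m. step False (\<lambda>m. ennreal (y ^ m)) m)"
proof -
  have "(\<integral>\<^sup>+t. indicator {0..1} t * ennreal (1 / (1 - t * y)) \<partial>lborel)
      = (\<integral>\<^sup>+t. (\<Sum>m. indicator {0..1} t * ennreal ((t * y) ^ m)) \<partial>lborel)"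
  proof (rule nn_integral_cong_AE)
    \<comment> \<open>At \<open>t * y = 1\<close> the left-hand side is the junk value \<open>1 / 0 = 0\<close>, the series diverges.\<close>
    have "AE t in lborel. t \<noteq> (1::real)" by (rule AE_lborel_singleton)
    then show "AE t in lborel. indicator {0..1} t * ennreal (1 / (1 - t * y))
        = (\<Sum>m. indicator {0..1} t * ennreal ((t * y) ^ m))"
    proof eventually_elim
      case (elim t)
      show ?case
      proof (cases "t \<in> {0..1}")
        case True
        then have t: "0 \<le> t" "t < 1" using elim by auto
        then have "t * y \<le> t * 1" using y by (intro mult_left_mono) auto
        then have ty: "0 \<le> t * y" "t * y < 1" using t y by auto
        then have "(\<Sum>m. ennreal ((t * y) ^ m)) = ennreal (1 / (1 - t * y))"
          by (intro suminf_ennreal_eq geometric_sums) auto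
        then show ?thesis using True by simp
      qed simp
    qed
  qed
  also have "\<dots> = (\<Sum>m. \<integral>\<^sup>+t. indicator {0..1} t * ennreal ((t * y) ^ m) \<partial>lborel)"
    by (intro nn_integral_suminf) simp
  also have "\<dots> = (\<Sum>m. step False (\<lambda>m. ennreal (y ^ m)) m)"
    using integral_unit_step[OF y, of False] by simp
  finally show ?thesis .
qed

text \<open>The outermost letter \<open>False\<close> produces the geometric series; its terms are
  then moments in the remaining coordinates.\<close>

lemma integral_nest_geometric:
  assumes e: "0 \<le> e" "e \<le> 1"
  shows "(\<integral>\<^sup>+x. indicator (PiE {k..<k + length (False # s)} (\<lambda>_. {0..1})) x *
             ennreal (1 / (1 - nest (False # s) e k x))
           \<partial>PiM {k..<k + length (False # s)} (\<lambda>_. lborel)) = wsum (False # s) (\<lambda>m. ennreal (e ^ m))"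
proof -
  define I where "I = {Suc k..<Suc k + length s}"
  define M where "M = PiM I (\<lambda>_. lborel :: real measure)"
  define u where "u = (indicator (PiE I (\<lambda>_. {0..1})) :: (nat \<Rightarrow> real) \<Rightarrow> ennreal)"
  have [measurable]: "u \<in> borel_measurable M" "nest s e (Suc k) \<in> borel_measurable M"
    unfolding u_def M_def I_def
    by (auto intro!: borel_measurable_indicator PiE_unit_measurable nest_measurable)
  have moment: "(\<integral>\<^sup>+x. u x * ennreal (nest s e (Suc k) x ^ m) \<partial>M) = steps s (\<lambda>m. ennreal (e ^ m)) m" for m
    unfolding u_def M_def I_def by (rule nest_moment[OF e])
  have "(\<integral>\<^sup>+x. indicator (PiE {k..<k + length (False # s)} (\<lambda>_. {0..1})) x *
             ennreal (1 / (1 - nest (False # s) e k x))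
           \<partial>PiM {k..<k + length (False # s)} (\<lambda>_. lborel))
      = (\<integral>\<^sup>+x. u x * (\<Sum>m. step False (\<lambda>m. ennreal (nest s e (Suc k) x ^ m)) m) \<partial>M)"
    unfolding u_def M_def I_def
    by (rule integral_nest_Cons[OF e]) (simp_all add: integral_unit_geometric)
  also have "\<dots> = (\<integral>\<^sup>+x. (\<Sum>m. ennreal (1 / real (Suc m)) * (u x * ennreal (nest s e (Suc k) x ^ m))) \<partial>M)"
    by (intro nn_integral_cong)
       (simp add: step_def mult.left_commute flip: ennreal_suminf_cmult)
  also have "\<dots> = (\<Sum>m. \<integral>\<^sup>+x. ennreal (1 / real (Suc m)) * (u x * ennreal (nest s e (Suc k) x ^ m)) \<partial>M)"
    by (intro nn_integral_suminf) measurable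
  also have "\<dots> = (\<Sum>m. ennreal (1 / real (Suc m)) * steps s (\<lambda>m. ennreal (e ^ m)) m)"
    by (simp add: nn_integral_cmult moment del: of_nat_Suc)
  finally show ?thesis by (simp add: wsum_def step_def)
qed

section \<open>Increasing sequences as words with infinitely many letter changes\<close>

text \<open>Coordinate \<open>x\<^sub>t\<^sub>+\<^sub>1\<close> belongs to the letter \<open>parity i t\<close>; the letters change exactly at the terms
  of \<open>i\<close>.\<close>

definition parity :: "(nat \<Rightarrow> nat) \<Rightarrow> nat \<Rightarrow> bool" where
  "parity i t \<longleftrightarrow> odd (card (range i \<inter> {..t}))"

text \<open>Exactly the \<open>r + 1\<close> terms \<open>i 0, ..., i r\<close> are at most
  \<open>t\<close>, so an even \<open>r\<close> gives an odd count.\<close>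

lemma parity_block:
  assumes "strict_mono i" "i r \<le> t" "t < i (Suc r)"
  shows "parity i t = even r"
proof -
  have "i j \<le> t \<longleftrightarrow> j \<le> r" for j
  proof
    assume "i j \<le> t"
    then have "i j < i (Suc r)" using assms(3) by simp
    then show "j \<le> r" using assms(1) by (simp add: strict_mono_less)
  next
    assume "j \<le> r"
    then have "i j \<le> i r" using assms(1) by (simp add: strict_mono_less_eq)
    then show "i j \<le> t" using assms(2) by simp
  qed
  then have "range i \<inter> {..t} = i ` {..r}" by auto
  moreover have "inj_on i {..r}"
    using assms(1) strict_mono_imp_inj_on inj_on_subset by blast
  ultimately show ?thesis by (simp add: parity_def card_image)
qed

lemma parity_start:
  assumes "strict_mono i" "t < i 0"
  shows "\<not> parity i t"
proof -
  have "i 0 \<le> i j" for j using assms(1) by (simp add: strict_mono_less_eq)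
  then have "t < i j" for j using assms(2) by (rule less_le_trans[rotated])
  then have "range i \<inter> {..t} = {}" by (auto dest: leD)
  then show ?thesis by (simp add: parity_def)
qed

lemma parity_Suc_neq_iff: "parity i (Suc t) \<noteq> parity i t \<longleftrightarrow> Suc t \<in> range i"
proof (cases "Suc t \<in> range i")
  case True
  then have "range i \<inter> {..Suc t} = insert (Suc t) (range i \<inter> {..t})" by (auto simp: le_Suc_eq)
  then show ?thesis using True by (simp add: parity_def)
next
  case False
  then have "range i \<inter> {..Suc t} = range i \<inter> {..t}" by (auto simp: le_Suc_eq) (metis rangeI)
  then show ?thesis using False by (simp add: parity_def)
qed

lemma alternating_parity:
  assumes "i \<in> seqA"
  shows "alternating (parity i)"
proof -
  have i: "strict_mono i" "0 < i 0" using assms by (auto simp: seqA_def)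
  have "parity i (i r) = even r" for r
    using i(1) by (intro parity_block) (auto simp: strict_mono_less)
  moreover have "n \<le> i (2 * n)" "n \<le> i (Suc (2 * n))" for n
    using strict_mono_imp_increasing[OF i(1), of "2 * n"]
      strict_mono_imp_increasing[OF i(1), of "Suc (2 * n)"] by linarith+
  ultimately show ?thesis
    using parity_start[OF i] unfolding alternating_def
    by (metis even_Suc even_mult_iff even_numeral)
qed

lemma strict_mono_range_eqD:
  fixes i j :: "nat \<Rightarrow> nat"
  assumes "strict_mono i" "strict_mono j" "range i = range j"
  shows "i = j"
proof
  fix n show "i n = j n"
  proof (induction n rule: less_induct)
    case (less n)
    have "a n \<le> b n" if ab: "strict_mono a" "strict_mono b" "range a = range b" "\<And>m. m < n \<Longrightarrow> a m = b m"
      for a b :: "nat \<Rightarrow> nat"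
    proof -
      obtain m where m: "b n = a m" using ab(3) by (metis rangeE rangeI)
      have "\<not> m < n"
        using m ab(2,4) by (metis less_irrefl strict_mono_less)
      then show ?thesis using m ab(1) by (simp add: strict_mono_less_eq)
    qed
    from this[OF assms less] this[OF assms(2,1) assms(3)[symmetric] less[symmetric]]
    show ?case by simp
  qed
qed

text \<open>The letter changes reveal all positive elements of the range of \<open>i\<close>, and 0
  is never a term; a strictly increasing sequence is determined by its range.\<close>

lemma parity_inj: "inj_on parity seqA"
proof (rule inj_onI)
  fix i j assume i: "i \<in> seqA" and j: "j \<in> seqA" and eq: "parity i = parity j"
  have "0 \<notin> range k" if "k \<in> seqA" for k
  proof -
    have "k 0 \<le> k n" "0 < k 0" for n using that by (auto simp: seqA_def strict_mono_less_eq)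
    then show ?thesis by (metis not_le rangeE)
  qed
  then have "t \<in> range i \<longleftrightarrow> t \<in> range j" for t
    using i j eq parity_Suc_neq_iff[of i] parity_Suc_neq_iff[of j] by (cases t) auto
  then show "i = j"
    using i j by (intro strict_mono_range_eqD) (auto simp: seqA_def)
qed

text \<open>The required sequence enumerates the positions at which \<open>w\<close> changes. There
  are infinitely many, since otherwise \<open>w\<close> would be eventually constant.\<close>

lemma parity_surj:
  assumes "alternating w"
  shows "\<exists>i\<in>seqA. parity i = w"
proof -
  define C where "C = {Suc t | t. w (Suc t) \<noteq> w t}"
  have inf: "infinite C"
  proof
    assume "finite C"
    then obtain N where N: "\<And>t. t \<in> C \<Longrightarrow> t \<le> N" using finite_nat_set_iff_bounded_le by auto
    have "w (N + k) = w N" for k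
    proof (induction k)
      case (Suc k)
      have "Suc (N + k) \<notin> C" using N by fastforce
      then show ?case using Suc by (auto simp: C_def)
    qed simp
    then have "w t = w N" if "N \<le> t" for t using that le_Suc_ex by blast
    then show False using assms unfolding alternating_def by metis
  qed
  define i where "i = enumerate C"
  have i: "strict_mono i" "range i = C"
    using inf by (auto simp: i_def strict_mono_enumerate range_enumerate)
  have "0 \<notin> range i" by (auto simp: i C_def)
  then have i0: "0 < i 0" by (metis gr0I rangeI)
  have "parity i t = w t" for t
  proof (induction t)
    case 0
    then show ?case using parity_start[OF i(1) i0] assms by (simp add: alternating_def)
  next
    case (Suc t)
    have "Suc t \<in> range i \<longleftrightarrow> w (Suc t) \<noteq> w t" by (auto simp: i C_def)
    then show ?case using parity_Suc_neq_iff[of i t] Suc by auto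
  qed
  then show ?thesis using i(1) i0 by (intro bexI[of _ i]) (auto simp: seqA_def)
qed

section \<open>Denominators, integrals and their limit\<close>

lemma nest_append: "nest (s @ t) e k x = nest s (nest t e (k + length s) x) k x"
  by (induction s arbitrary: k) auto

text \<open>The innermost value enters with the full product as its slope, so altering that value by
  a product of further coordinates changes \<open>nest\<close> by a single monomial.\<close>

lemma nest_affine:
  "nest s e k x = nest s 0 k x + (\<Prod>m\<in>{k..<k + length s}. x m) * e"
proof (induction s arbitrary: k)
  case (Cons b s)
  have "(\<Prod>m\<in>{k..<k + length (b # s)}. x m) = x k * (\<Prod>m\<in>{Suc k..<Suc k + length s}. x m)"
    unfolding atLeastLessThan_Suc_insert by (subst prod.insert) auto
  then show ?case
    using Cons[of "Suc k"] by (auto simp: algebra_simps)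
qed simp

lemma nest_replicate:
  "nest (replicate n b) e k x =
     (if b then 1 - (\<Prod>m\<in>{k..<k + n}. x m) * (1 - e) else (\<Prod>m\<in>{k..<k + n}. x m) * e)"
proof (induction n arbitrary: k)
  case (Suc n)
  have eq: "(\<Prod>m\<in>{k..<k + Suc n}. x m) = x k * (\<Prod>m\<in>{Suc k..<Suc k + n}. x m)"
    using prod.atLeast_Suc_lessThan[of k "k + Suc n" x] by simp
  show ?case
    unfolding replicate_Suc nest.simps Suc[of "Suc k"] eq by (cases b) simp_all
qed simp

lemma pre_add_const:
  assumes "\<And>t. a \<le> t \<Longrightarrow> t < a + n \<Longrightarrow> w t = b"
  shows "pre w (a + n) = pre w a @ replicate n b"
  using assms by (induction n) (auto simp: pre_Suc replicate_append_same)

text \<open>Appending the next block replaces the innermost value 1 by \<open>1 - Q\<close>, or 0 by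
  \<open>Q\<close>. Multiplied by the prefix product \<open>P (i r)\<close>, this change is the next
  alternating monomial up to sign.\<close>

lemma denom_eq_nest:
  assumes "i \<in> seqA"
  shows "denom i (Suc r) x = 1 - nest (pre (parity i) (i r)) (if even r then 1 else 0) 1 x"
proof -
  define P where "P n = (\<Prod>m\<in>{1..<1 + n}. x m)" for n
  have denom_Suc: "denom i (Suc r) x = denom i r x + (-1) ^ Suc r * P (i r)" for r
    unfolding denom_def by (simp add: P_def atLeastLessThanSuc_atLeastAtMost)
  have i: "strict_mono i" using assms by (simp add: seqA_def)
  show ?thesis
  proof (induction r)
    case 0
    have "pre (parity i) (0 + i 0) = pre (parity i) 0 @ replicate (i 0) False"
      by (rule pre_add_const) (simp add: parity_start[OF i])
    then show ?case
      unfolding denom_Suc by (simp add: nest_replicate P_def) (simp add: denom_def)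
  next
    case (Suc r)
    define s where "s = pre (parity i) (i r)"
    have len: "length s = i r" by (simp add: s_def)
    define n where "n = i (Suc r) - i r"
    have n: "i r + n = i (Suc r)" using i by (simp add: n_def strict_mono_less_eq)
    define Q where "Q = (\<Prod>m\<in>{1 + i r..<1 + i r + n}. x m)"
    have PQ: "P (i (Suc r)) = P (i r) * Q"
      unfolding P_def Q_def n[symmetric] add.assoc[symmetric]
      by (rule prod.atLeastLessThan_concat[symmetric]) auto
    have "pre (parity i) (i r + n) = s @ replicate n (even r)"
      unfolding s_def using n by (intro pre_add_const parity_block[OF i]) auto
    then have "nest (pre (parity i) (i (Suc r))) (if even (Suc r) then 1 else 0) 1 x
        = nest s (if even r then 1 - Q else Q) 1 x"
      by (simp add: n nest_append nest_replicate len Q_def)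
    also have "\<dots> = nest s 0 1 x + P (i r) * (if even r then 1 - Q else Q)"
      by (subst nest_affine) (simp add: P_def len)
    also have "\<dots> = nest s (if even r then 1 else 0) 1 x - (-1) ^ Suc (Suc r) * P (i (Suc r))"
      unfolding PQ by (subst (2) nest_affine) (auto simp: P_def len algebra_simps)
    finally show ?case using Suc denom_Suc[of "Suc r"] by (simp add: s_def)
  qed
qed

lemma Iint_eq:
  assumes "i \<in> seqA"
  shows "Iint i (Suc r) = (if even r then upper else lower) (pre (parity i) (i r))"
proof -
  have i: "strict_mono i" "0 < i 0" using assms by (auto simp: seqA_def)
  have "i 0 \<le> i r" using i(1) by (simp add: strict_mono_less_eq)
  then obtain n where n: "i r = Suc n" using i(2) by (cases "i r") auto
  define s where "s = pre (\<lambda>k. parity i (Suc k)) n"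
  have s: "pre (parity i) (i r) = False # s"
    using parity_start[OF i] by (simp add: n s_def pre_Suc_Cons)
  have I: "{1..i r} = {1..<1 + length (False # s)}" by (auto simp: n s_def)
  define e :: real where "e = (if even r then 1 else 0)"
  have "Iint i (Suc r) = wsum (False # s) (\<lambda>m. ennreal (e ^ m))"
    unfolding Iint_def denom_eq_nest[OF assms] e_def[symmetric] s diff_Suc_1 I
    by (rule integral_nest_geometric) (auto simp: e_def)
  \<comment> \<open>Since \<open>0 ^ 0 = 1\<close>, the powers of 0 form
    \<open>delta\<close>.\<close>
  moreover have "(\<lambda>m. ennreal (e ^ m)) = (if even r then (\<lambda>_. 1) else delta)"
    by (auto simp: e_def delta_def fun_eq_iff power_0_left)
  ultimately show ?thesis by (simp add: s upper_def lower_def)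
qed

text \<open>Squeeze: the integrals alternate between upper and lower endpoints of nested cells, and
  both endpoint sequences tend to the same point along the subsequence \<open>i\<close>.\<close>

lemma Iint_tendsto:
  assumes "i \<in> seqA"
  shows "Iint i \<longlonglongrightarrow> wlim (parity i)"
proof (rule LIMSEQ_imp_Suc, rule tendsto_sandwich)
  have i: "strict_mono i" using assms by (simp add: seqA_def)
  note alt = alternating_parity[OF assms]
  show "(\<lambda>r. lower (pre (parity i) (i r))) \<longlonglongrightarrow> wlim (parity i)"
    using LIMSEQ_subseq_LIMSEQ[OF lower_tendsto i] by (simp add: comp_def)
  show "(\<lambda>r. upper (pre (parity i) (i r))) \<longlonglongrightarrow> wlim (parity i)"
    using LIMSEQ_subseq_LIMSEQ[OF upper_tendsto i] alt by (simp add: comp_def alternating_def)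
  have le: "lower s \<le> upper s" for s
    using lower_le_middle middle_le_upper by (rule order_trans)
  show "\<forall>\<^sub>F r in sequentially. lower (pre (parity i) (i r)) \<le> Iint i (Suc r)"
       "\<forall>\<^sub>F r in sequentially. Iint i (Suc r) \<le> upper (pre (parity i) (i r))"
    by (auto simp: Iint_eq[OF assms] le)
qed

text \<open>Finiteness of the limit matters here, because \<open>enn2real\<close> sends
  \<open>top\<close> to 0.\<close>

lemma ennreal_xi:
  assumes "i \<in> seqA"
  shows "ennreal (xi i) = wlim (parity i)"
  unfolding xi_def limI[OF Iint_tendsto[OF assms]]
  using wlim_finite[OF alternating_parity[OF assms]] by simp

lemma xi_gt_1:
  assumes "i \<in> seqA"
  shows "1 < xi i"
  using wlim_gt_1[OF alternating_parity[OF assms]]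
  unfolding ennreal_xi[OF assms, symmetric] by simp

theorem theorem1p6:
  shows "(\<forall>i\<in>seqA. \<exists>L::real. L > 1 \<and> (\<lambda>r. Iint i r) \<longlonglongrightarrow> ennreal L)
       \<and> inj_on xi seqA
       \<and> xi ` seqA = {1<..} - Zstar"
proof (intro conjI ballI)
  fix i assume i: "i \<in> seqA"
  show "\<exists>L::real. L > 1 \<and> (\<lambda>r. Iint i r) \<longlonglongrightarrow> ennreal L"
    using Iint_tendsto[OF i] xi_gt_1[OF i] ennreal_xi[OF i] by metis
next
  show "inj_on xi seqA"
  proof (rule inj_onI)
    fix i j assume ij: "i \<in> seqA" "j \<in> seqA" "xi i = xi j"
    then have "parity i = parity j"
      by (intro wlim_inj alternating_parity) (simp_all flip: ennreal_xi)
    then show "i = j" using ij parity_inj by (auto dest: inj_onD)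
  qed
next
  show "xi ` seqA = {1<..} - Zstar"
  proof (intro equalityI subsetI)
    fix x assume "x \<in> xi ` seqA"
    then obtain i where i: "i \<in> seqA" "x = xi i" by blast
    have "ennreal x \<notin> ennreal ` Zstar"
      unfolding ennreal_Zstar i(2) ennreal_xi[OF i(1)]
      using middle_neq_wlim[OF alternating_parity[OF i(1)]] by (metis rangeE)
    then show "x \<in> {1<..} - Zstar" using i xi_gt_1 by auto
  next
    fix x assume x: "x \<in> {1<..} - Zstar"
    have "ennreal x \<notin> ennreal ` Zstar"
    proof
      assume "ennreal x \<in> ennreal ` Zstar"
      then obtain y where "y \<in> Zstar" "ennreal x = ennreal y" by blast
      \<comment> \<open>\<open>ennreal\<close> is injective only on nonnegative reals, hence the
        appeal to the sign of \<open>zeta_star\<close>.\<close>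
      then have "x = y" using x zeta_star_nonneg by (auto simp: Zstar_def ennreal_inj)
      with \<open>y \<in> Zstar\<close> x show False by simp
    qed
    then have "ennreal x \<noteq> middle (False # s)" for s
      unfolding ennreal_Zstar by blast
    then obtain w where w: "alternating w" "wlim w = ennreal x"
      using wlim_surj[of "ennreal x"] x by auto
    then obtain i where i: "i \<in> seqA" "parity i = w" using parity_surj by blast
    then have "ennreal (xi i) = ennreal x" using ennreal_xi w by simp
    then have "xi i = x" using x xi_gt_1[OF i(1)] by (subst (asm) ennreal_inj) auto
    then show "x \<in> xi ` seqA" using i(1) by blast
  qed
qed

end
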